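(* Let $G$ be a graph of order $n\ge 2$ and let $H$ be a nonempty graph of order $n'$. Then the following assertions hold. (i) $\gamma_{\rm sp}(G\circ H)\ge n\,\gamma_{\rm sp}(H)$. (ii) If $G$ is connected, then $\gamma_{\rm sp}(G\circ H)=n\,\gamma_{\rm sp}(H)$ if and only if $G\cong K_2$, $\gamma_{\rm sp}(H)=n'-1$ and $H\not\cong K_{n'}$.
   Context: All graphs are finite, simple and undirected, with nonempty vertex set; the order of a graph is its number of vertices. An empty graph is a graph without edges, and a nonempty graph is one with at least one edge. $K_m$ is the complete graph of order $m$. For a vertex $v$ of $G$, $N(v)$ is the set of vertices adjacent to $v$, and for $D\subseteq V(G)$, $\overline{D}=V(G)\setminus D$. A set $D\subseteq V(G)$ is a super dominating set of $G$ if for every $u\in\overline{D}$ there exists $v\in D$ such that $N(v)\cap\overline{D}=\{u\}$. The super domination number $\gamma_{\rm sp}(G)$ is the minimum cardinality of a super dominating set of $G$. The lexicographic product $G\circ H$ has vertex set $V(G)\times V(H)$, and $(g,h)$ is adjacent to $(g',h')$ if and only if $gg'\in E(G)$, or $g=g'$ and $hh'\in E(H)$. *)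

theory Defs
  imports "Graph_Theory.Graph_Theory"
begin

(* A finite simple undirected graph is a pair_graph: a finite loop-free digraph whose arcs
   are ordered pairs of vertices and form a symmetric relation. An undirected edge uv is
   represented by the two arcs (u,v) and (v,u). The locale allows the null graph. *)

definition neighborhood :: "'a pair_pre_digraph \<Rightarrow> 'a \<Rightarrow> 'a set" where
  "neighborhood G v = {u \<in> pverts G. (v, u) \<in> parcs G}"

definition nonempty_graph :: "'a pair_pre_digraph \<Rightarrow> bool" where
  "nonempty_graph G \<longleftrightarrow> parcs G \<noteq> {}"

definition super_dominating :: "'a pair_pre_digraph \<Rightarrow> 'a set \<Rightarrow> bool" where
  "super_dominating G D \<longleftrightarrow> D \<subseteq> pverts G \<and>
     (\<forall>u \<in> pverts G - D. \<exists>v \<in> D. neighborhood G v \<inter> (pverts G - D) = {u})"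

(* The whole vertex set is always super dominating, so for a finite graph this is the
   minimum of a finite nonempty set. *)
definition super_domination_number :: "'a pair_pre_digraph \<Rightarrow> nat" where
  "super_domination_number G = Min (card ` {D. super_dominating G D})"

definition lexicographic_product ::
    "'a pair_pre_digraph \<Rightarrow> 'b pair_pre_digraph \<Rightarrow> ('a \<times> 'b) pair_pre_digraph" where
  "lexicographic_product G H =
     \<lparr> pverts = pverts G \<times> pverts H,
       parcs = {((g, h), (g', h')) | g h g' h'.
         (g, h) \<in> pverts G \<times> pverts H \<and> (g', h') \<in> pverts G \<times> pverts H \<and>
         ((g, g') \<in> parcs G \<or> g = g' \<and> (h, h') \<in> parcs H)} \<rparr>"

lemma pair_graph_lexicographic_product:
  assumes "pair_graph G" and "pair_graph H"
  shows "pair_graph (lexicographic_product G H)"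
proof -
  interpret G: pair_graph G by fact
  interpret H: pair_graph H by fact
  let ?P = "lexicographic_product G H"
  have "parcs ?P \<subseteq> pverts ?P \<times> pverts ?P"
    by (auto simp: lexicographic_product_def)
  moreover have fin: "finite (pverts ?P)"
    by (simp add: lexicographic_product_def G.pair_finite_verts H.pair_finite_verts)
  ultimately have "finite (parcs ?P)"
    by (meson finite_SigmaI finite_subset)
  moreover have "symmetric (with_proj ?P)"
    using G.pair_sym_arcs H.pair_sym_arcs
    by (auto simp: symmetric_def lexicographic_product_def sym_def)
  ultimately show ?thesis
    using fin G.pair_no_loops H.pair_no_loops
    by unfold_locales (fastforce simp: lexicographic_product_def)+
qed

end

theory Submission
  imports Defs
begin

text \<open>
  Let \<open>D\<close> be super dominating in the product \<open>G \<circ> H\<close> and call \<open>D `` {g}\<close>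
  its fibre over a vertex \<open>g\<close> of \<open>G\<close>. The neighbourhood of \<open>(a, b)\<close> consists of the copies of
  \<open>H\<close> over all neighbours of \<open>a\<close>, completely, together with \<open>N(b)\<close> in the copy over \<open>a\<close>.
  Hence a vertex \<open>(g, h)\<close> outside \<open>D\<close> is privately dominated in one of only two ways
  (lemma \<open>fibre_dichotomy\<close>): by a vertex over \<open>g\<close>, which then dominates \<open>h\<close> privately in \<open>H\<close> and
  forces the fibres over all neighbours of \<open>g\<close> to be full; or by a vertex over a neighbour \<open>a\<close> of
  \<open>g\<close>, in which case \<open>h\<close> is the only vertex missing from the fibre over \<open>g\<close>.

  So each fibre is super dominating in \<open>H\<close> or misses at most one vertex. As \<open>H\<close> has an edge,
  either way it has at least \<open>\<gamma>\<^sub>s\<^sub>p(H)\<close> elements (lemma \<open>super_domination_number_le_card_fibre\<close>),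
  and summing over \<open>g\<close> gives the inequality.

  Equality forces every fibre to have exactly \<open>\<gamma>\<^sub>s\<^sub>p(H)\<close> elements, so no fibre is full. If \<open>G\<close> has no
  isolated vertex this excludes the first kind of domination. The second kind then gives, for each
  \<open>g\<close>, a vertex \<open>a\<close> with \<open>N(a) = {g}\<close>; applied to \<open>a\<close> in turn it gives \<open>N(g) = {a}\<close>, so a connected
  \<open>G\<close> is \<open>K\<^sub>2\<close>. Moreover every fibre misses just one vertex, so \<open>\<gamma>\<^sub>s\<^sub>p(H) = n' - 1\<close>, and the vertex over
  \<open>a\<close> that dominates \<open>(g, h)\<close> lies in \<open>D\<close> and is not adjacent to the vertex missing over \<open>a\<close>, so \<open>H\<close>
  is not complete. Conversely, if \<open>b\<close> and \<open>c\<close> are distinct and not adjacent in \<open>H\<close>, the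
  complement of \<open>{(x, c), (y, c)}\<close> in \<open>K\<^sub>2 \<circ> H\<close> is super dominating, because \<open>(y, b)\<close> dominates
  \<open>(x, c)\<close> privately and \<open>(x, b)\<close> dominates \<open>(y, c)\<close> privately.
\<close>

section \<open>The super domination number\<close>

lemma finite_super_dominating_sets:
  assumes "finite (pverts G)"
  shows "finite {D. super_dominating G D}"
  by (rule finite_subset[of _ "Pow (pverts G)"]) (use assms in \<open>auto simp: super_dominating_def\<close>)

lemma super_domination_number_le:
  assumes "finite (pverts G)" and "super_dominating G D"
  shows "super_domination_number G \<le> card D"
  using assms finite_super_dominating_sets[OF assms(1)]
  by (auto simp: super_domination_number_def intro!: Min_le)

lemma super_domination_number_attained:
  assumes "finite (pverts G)"
  obtains D where "super_dominating G D" and "card D = super_domination_number G"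
proof -
  have "super_dominating G (pverts G)"
    by (auto simp: super_dominating_def)
  then have "super_domination_number G \<in> card ` {D. super_dominating G D}"
    unfolding super_domination_number_def
    using finite_super_dominating_sets[OF assms] by (intro Min_in) auto
  then show thesis
    using that by auto
qed

text \<open>An end of an edge can be left out: the other end dominates it.\<close>

lemma super_domination_number_le_order_minus_1:
  assumes "pair_graph G" and "nonempty_graph G"
  shows "super_domination_number G \<le> card (pverts G) - 1"
proof -
  interpret pair_graph G by fact
  obtain v u where arc: "(v, u) \<in> parcs G"
    using assms(2) by (auto simp: nonempty_graph_def)
  then have vu: "v \<in> pverts G" "u \<in> pverts G" "v \<noteq> u"
    using in_arcsD1 in_arcsD2 pair_no_loops by fastforce+
  have "neighborhood G v \<inter> (pverts G - (pverts G - {u})) = {u}"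
    using arc vu by (auto simp: neighborhood_def)
  then have "super_dominating G (pverts G - {u})"
    using vu unfolding super_dominating_def by blast
  from super_domination_number_le[OF pair_finite_verts this] show ?thesis
    using vu by (simp add: pair_finite_verts)
qed


section \<open>Fibres of a super dominating set of the product\<close>

lemma pverts_lexicographic_product [simp]:
  "pverts (lexicographic_product G H) = pverts G \<times> pverts H"
  by (simp add: lexicographic_product_def)

lemma neighborhood_lexicographic_product:
  assumes "a \<in> pverts G" and "b \<in> pverts H"
  shows "neighborhood (lexicographic_product G H) (a, b) =
    neighborhood G a \<times> pverts H \<union> {a} \<times> neighborhood H b"
  using assms by (auto simp: neighborhood_def lexicographic_product_def)

lemma card_eq_sum_card_fibres:
  assumes "finite A" and "finite B" and "D \<subseteq> A \<times> B"
  shows "card D = (\<Sum>g\<in>A. card (D `` {g}))"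
proof -
  have "D = (SIGMA g:A. D `` {g})"
    using assms(3) by auto
  then have "card D = card (SIGMA g:A. D `` {g})"
    by (rule arg_cong)
  also have "\<dots> = (\<Sum>g\<in>A. card (D `` {g}))"
    using assms by (intro card_SigmaI ballI) (auto intro: finite_subset[of _ B])
  finally show ?thesis .
qed

text \<open>
  The two alternatives are whether the vertex \<open>(a, b)\<close> that dominates \<open>(g, h)\<close> privately has
  \<open>a = g\<close> or has \<open>a\<close> adjacent to \<open>g\<close>. Its private neighbourhood is a single vertex, while it
  sees all of the copies of \<open>H\<close> over the neighbours of \<open>a\<close>; so these copies contain no vertex outside
  \<open>D\<close> other than possibly \<open>(g, h)\<close>.
\<close>

lemma fibre_dichotomy:
  assumes "pair_graph G"
    and sd: "super_dominating (lexicographic_product G H) D"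
    and g: "g \<in> pverts G" and h: "h \<in> pverts H - D `` {g}"
  shows "(\<exists>b \<in> D `` {g}. neighborhood H b \<inter> (pverts H - D `` {g}) = {h}) \<and>
      (\<forall>a \<in> neighborhood G g. pverts H \<subseteq> D `` {a})
    \<or> pverts H - D `` {g} = {h} \<and>
      (\<exists>a \<in> pverts G. \<exists>b \<in> D `` {a}. g \<in> neighborhood G a \<and>
        (\<forall>g' \<in> neighborhood G a - {g}. pverts H \<subseteq> D `` {g'}) \<and>
        neighborhood H b \<inter> (pverts H - D `` {a}) = {})"
proof -
  interpret G: pair_graph G by fact
  have sub: "D \<subseteq> pverts G \<times> pverts H"
    using sd by (simp add: super_dominating_def)
  have "(g, h) \<in> pverts G \<times> pverts H - D"
    using g h by auto
  then have "\<exists>v \<in> D. neighborhood (lexicographic_product G H) v \<inter> (pverts G \<times> pverts H - D) = {(g, h)}"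
    using sd unfolding super_dominating_def pverts_lexicographic_product by blast
  then obtain a b where ab: "(a, b) \<in> D"
    and only: "neighborhood (lexicographic_product G H) (a, b) \<inter> (pverts G \<times> pverts H - D) = {(g, h)}"
    by (metis surj_pair)
  have ab_verts: "a \<in> pverts G" "b \<in> pverts H"
    using ab sub by auto
  have priv: "(neighborhood G a \<times> pverts H \<union> {a} \<times> neighborhood H b) \<inter>
      (pverts G \<times> pverts H - D) = {(g, h)}"
    using only unfolding neighborhood_lexicographic_product[OF ab_verts] .
  have nb: "neighborhood G a \<subseteq> pverts G" "neighborhood H b \<subseteq> pverts H" "a \<notin> neighborhood G a"
    using G.pair_no_loops by (fastforce simp: neighborhood_def)+
  have over_nb: "x = g \<and> y = h" if "x \<in> neighborhood G a" "y \<in> pverts H - D `` {x}" for x y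
  proof -
    have "(x, y) \<in> {(g, h)}"
      unfolding priv[symmetric] using that nb by auto
    then show ?thesis by simp
  qed
  have over_a: "a = g \<and> y = h" if "y \<in> neighborhood H b" "y \<in> pverts H - D `` {a}" for y
  proof -
    have "(a, y) \<in> {(g, h)}"
      unfolding priv[symmetric] using that ab_verts by auto
    then show ?thesis by simp
  qed
  have "(g, h) \<in> neighborhood G a \<times> pverts H \<union> {a} \<times> neighborhood H b"
    using priv by blast
  then consider "a = g" "h \<in> neighborhood H b" | "g \<in> neighborhood G a"
    by auto
  then show ?thesis
  proof cases
    case 1
    then have "neighborhood H b \<inter> (pverts H - D `` {g}) = {h}"
      using over_a h by blast
    moreover have "pverts H \<subseteq> D `` {x}" if "x \<in> neighborhood G g" for x
      using over_nb that nb(3) 1 by blast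
    moreover have "b \<in> D `` {g}"
      using ab 1 by simp
    ultimately show ?thesis by blast
  next
    case 2
    then have "pverts H - D `` {g} = {h}"
      using over_nb h by blast
    moreover have "pverts H \<subseteq> D `` {x}" if "x \<in> neighborhood G a - {g}" for x
      using over_nb that by blast
    moreover have "neighborhood H b \<inter> (pverts H - D `` {a}) = {}"
      using over_a 2 nb(3) by blast
    moreover have "b \<in> D `` {a}"
      using ab by simp
    ultimately show ?thesis
      using 2 ab_verts(1) by blast
  qed
qed

text \<open>
  A fibre that misses exactly one vertex need not be super dominating in \<open>H\<close>, since the missing
  vertex may be dominated from another copy. Then the edge of \<open>H\<close> yields the bound.
\<close>

lemma super_domination_number_le_card_fibre:
  assumes "pair_graph G" and "pair_graph H" and "nonempty_graph H"
    and sd: "super_dominating (lexicographic_product G H) D" and g: "g \<in> pverts G"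
  shows "super_domination_number H \<le> card (D `` {g})"
proof -
  interpret H: pair_graph H by fact
  have sub: "D `` {g} \<subseteq> pverts H"
    using sd by (auto simp: super_dominating_def)
  show ?thesis
  proof (cases "\<exists>h. pverts H - D `` {g} = {h}")
    case True
    then obtain h where "pverts H - D `` {g} = {h}" by blast
    then have "D `` {g} = pverts H - {h}" and "h \<in> pverts H"
      using sub by auto
    then show ?thesis
      using super_domination_number_le_order_minus_1[OF assms(2,3)]
      by (simp add: H.pair_finite_verts)
  next
    case False
    then have "super_dominating H (D `` {g})"
      using fibre_dichotomy[OF assms(1) sd g] sub unfolding super_dominating_def by blast
    then show ?thesis
      by (rule super_domination_number_le[OF H.pair_finite_verts])
  qed
qed


section \<open>The lower bound and the case of equality\<close>

lemma super_domination_number_product_eq_sum_card_fibres: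
  assumes "finite (pverts G)" and "finite (pverts H)"
  obtains D where "super_dominating (lexicographic_product G H) D"
    and "super_domination_number (lexicographic_product G H) = (\<Sum>g\<in>pverts G. card (D `` {g}))"
proof -
  have "finite (pverts (lexicographic_product G H))"
    using assms by simp
  then obtain D where D: "super_dominating (lexicographic_product G H) D"
    "card D = super_domination_number (lexicographic_product G H)"
    by (rule super_domination_number_attained)
  then have "D \<subseteq> pverts G \<times> pverts H"
    by (simp add: super_dominating_def)
  from card_eq_sum_card_fibres[OF assms this] show thesis
    using that[OF D(1)] D(2) by simp
qed

lemma super_domination_number_lexicographic_product_ge:
  assumes "pair_graph G" and "pair_graph H" and "nonempty_graph H"
  shows "card (pverts G) * super_domination_number H
    \<le> super_domination_number (lexicographic_product G H)"
proof -
  interpret G: pair_graph G by fact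
  interpret H: pair_graph H by fact
  obtain D where sd: "super_dominating (lexicographic_product G H) D"
    and "super_domination_number (lexicographic_product G H) = (\<Sum>g\<in>pverts G. card (D `` {g}))"
    using super_domination_number_product_eq_sum_card_fibres[OF G.pair_finite_verts H.pair_finite_verts] .
  moreover have "(\<Sum>g\<in>pverts G. super_domination_number H) \<le> (\<Sum>g\<in>pverts G. card (D `` {g}))"
    using super_domination_number_le_card_fibre[OF assms sd] by (intro sum_mono)
  ultimately show ?thesis
    by simp
qed

lemma obtain_tight_fibres:
  assumes "pair_graph G" and "pair_graph H" and "nonempty_graph H"
    and eq: "super_domination_number (lexicographic_product G H) =
      card (pverts G) * super_domination_number H"
  obtains D where "super_dominating (lexicographic_product G H) D"
    and "\<And>g. g \<in> pverts G \<Longrightarrow> card (D `` {g}) = super_domination_number H"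
proof -
  interpret G: pair_graph G by fact
  interpret H: pair_graph H by fact
  obtain D where sd: "super_dominating (lexicographic_product G H) D"
    and "super_domination_number (lexicographic_product G H) = (\<Sum>g\<in>pverts G. card (D `` {g}))"
    using super_domination_number_product_eq_sum_card_fibres[OF G.pair_finite_verts H.pair_finite_verts] .
  then have "(\<Sum>g\<in>pverts G. super_domination_number H) = (\<Sum>g\<in>pverts G. card (D `` {g}))"
    using eq by simp
  then have "card (D `` {g}) = super_domination_number H" if "g \<in> pverts G" for g
    using sum_mono_inv[OF _ _ that G.pair_finite_verts]
      super_domination_number_le_card_fibre[OF assms(1-3) sd] by metis
  then show thesis
    using that sd by blast
qed

text \<open>Connectedness enters only through the fact that a vertex set closed under adjacency is
  everything.\<close>

lemma connected_closed_eq_pverts: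
  assumes "pair_graph G" and "connected (with_proj G)"
    and x: "x \<in> S" and "S \<subseteq> pverts G" and closed: "\<And>y. y \<in> S \<Longrightarrow> neighborhood G y \<subseteq> S"
  shows "S = pverts G"
proof -
  interpret G: pair_graph G by fact
  have "y \<in> S" if "y \<in> pverts G" for y
  proof -
    have "x \<rightarrow>\<^sup>*\<^bsub>with_proj (mk_symmetric (with_proj G))\<^esub> y"
      using assms that unfolding connected_def strongly_connected_def by auto
    then have "x \<rightarrow>\<^sup>*\<^bsub>with_proj G\<^esub> y"
      by (simp only: G.reachable_mk_symmetric_eq[OF G.sym_arcs])
    then show "y \<in> S"
    proof (induction rule: G.reachable_induct)
      case base
      show ?case by (rule x)
    next
      case (step u v)
      then show ?case
        using closed[of u] G.in_arcsD2 by (auto simp: neighborhood_def)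
    qed
  qed
  then show ?thesis
    using assms(4) by blast
qed

lemma connected_has_neighbor:
  assumes "pair_graph G" and "connected (with_proj G)" and "card (pverts G) \<ge> 2"
    and "g \<in> pverts G"
  shows "neighborhood G g \<noteq> {}"
proof
  assume "neighborhood G g = {}"
  then have "{g} = pverts G"
    using connected_closed_eq_pverts[OF assms(1,2), of g "{g}"] assms(4) by simp
  then have "card (pverts G) = 1"
    by (metis is_singletonI is_singleton_altdef)
  then show False
    using assms(3) by simp
qed

lemma equality_imp_K2:
  assumes G: "pair_graph G" and H: "pair_graph H" "nonempty_graph H"
    and conn: "connected (with_proj G)" and order: "card (pverts G) \<ge> 2"
    and eq: "super_domination_number (lexicographic_product G H) =
      card (pverts G) * super_domination_number H"
  shows "complete_digraph 2 (with_proj G) \<and> super_domination_number H = card (pverts H) - 1 \<and>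
    \<not> complete_digraph (card (pverts H)) (with_proj H)"
proof -
  interpret G: pair_graph G by fact
  interpret H: pair_graph H by fact
  obtain D where sd: "super_dominating (lexicographic_product G H) D"
    and tight: "\<And>g. g \<in> pverts G \<Longrightarrow> card (D `` {g}) = super_domination_number H"
    using obtain_tight_fibres[OF G H eq] by blast
  have sub: "D `` {g} \<subseteq> pverts H" for g
    using sd by (auto simp: super_dominating_def)
  have "pverts H \<noteq> {}"
    using H(2) H.in_arcsD1 by (fastforce simp: nonempty_graph_def)
  then have "super_domination_number H < card (pverts H)"
    using super_domination_number_le_order_minus_1[OF H] H.pair_finite_verts
    by (metis card_gt_0_iff diff_less le_less_trans zero_less_one)
  then have not_full: "\<not> pverts H \<subseteq> D `` {g}" if "g \<in> pverts G" for g
    using tight[OF that] sub by (metis subset_antisym nat_neq_iff)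
  \<comment> \<open>No fibre is full and every vertex has a neighbour, so the domination comes from another copy.\<close>
  have outer: "\<exists>h. pverts H - D `` {g} = {h} \<and>
      (\<exists>a \<in> pverts G. \<exists>b \<in> D `` {a}. neighborhood G a = {g} \<and>
        neighborhood H b \<inter> (pverts H - D `` {a}) = {})" if g: "g \<in> pverts G" for g
  proof -
    obtain h where h: "h \<in> pverts H - D `` {g}"
      using not_full[OF g] by blast
    obtain x where "x \<in> neighborhood G g"
      using connected_has_neighbor[OF G conn order g] by blast
    then have "\<not> (\<forall>a \<in> neighborhood G g. pverts H \<subseteq> D `` {a})"
      using not_full by (auto simp: neighborhood_def)
    with fibre_dichotomy[OF G sd g h] have miss: "pverts H - D `` {g} = {h}"
      and "\<exists>a \<in> pverts G. \<exists>b \<in> D `` {a}. g \<in> neighborhood G a \<and>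
        (\<forall>g' \<in> neighborhood G a - {g}. pverts H \<subseteq> D `` {g'}) \<and>
        neighborhood H b \<inter> (pverts H - D `` {a}) = {}"
      by blast+
    then obtain a b where a: "a \<in> pverts G" and b: "b \<in> D `` {a}" "g \<in> neighborhood G a"
      "\<forall>g' \<in> neighborhood G a - {g}. pverts H \<subseteq> D `` {g'}"
      "neighborhood H b \<inter> (pverts H - D `` {a}) = {}"
      by blast
    have "neighborhood G a \<subseteq> pverts G"
      by (auto simp: neighborhood_def)
    then have "neighborhood G a = {g}"
      using b not_full by blast
    then show ?thesis
      using a b(1,4) miss by blast
  qed
  have "pverts G \<noteq> {}"
    using order by auto
  then obtain g where g: "g \<in> pverts G"
    by blast
  from outer[OF g] obtain h a b where h: "pverts H - D `` {g} = {h}" and a: "a \<in> pverts G"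
    and b: "b \<in> D `` {a}" "neighborhood H b \<inter> (pverts H - D `` {a}) = {}"
    and Na: "neighborhood G a = {g}"
    by blast
  \<comment> \<open>The vertex \<open>a'\<close> found for \<open>a\<close> is adjacent to \<open>a\<close>, whose only neighbour is \<open>g\<close>; hence \<open>a' = g\<close>.\<close>
  from outer[OF a] obtain c a' where c: "pverts H - D `` {a} = {c}"
    and a': "a' \<in> pverts G" "neighborhood G a' = {a}"
    by blast
  have "a' \<in> neighborhood G a"
    using a' a G.graph_symmetric[of a' a] by (auto simp: neighborhood_def)
  then have Ng: "neighborhood G g = {a}"
    using Na a' by simp
  have V: "pverts G = {g, a}"
    by (rule connected_closed_eq_pverts[OF G conn, of g, symmetric]) (use g a Na Ng in auto)
  have ga: "g \<noteq> a"
    using Na a G.pair_no_loops by (fastforce simp: neighborhood_def)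
  have "(g, a) \<in> parcs G" "(a, g) \<in> parcs G"
    using Na Ng by (auto simp: neighborhood_def)
  moreover have "parcs G \<subseteq> {(u, v). (u, v) \<in> pverts G \<times> pverts G \<and> u \<noteq> v}"
    by (auto dest: G.in_arcsD1 G.in_arcsD2 G.pair_no_loops)
  ultimately have "parcs G = {(u, v). (u, v) \<in> pverts G \<times> pverts G \<and> u \<noteq> v}"
    unfolding V by blast
  then have "complete_digraph 2 (with_proj G)"
    using ga unfolding complete_digraph_pair_def by (simp add: V)
  moreover have "super_domination_number H = card (pverts H) - 1"
  proof -
    have "D `` {g} = pverts H - {h}" "h \<in> pverts H"
      using h sub[of g] by auto
    then show ?thesis
      using tight[OF g] H.pair_finite_verts by simp
  qed
  moreover have "\<not> complete_digraph (card (pverts H)) (with_proj H)"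
  proof -
    have bc: "b \<in> pverts H" "c \<in> pverts H" "b \<noteq> c"
      using b(1) c sub by auto
    moreover have "(b, c) \<notin> parcs H"
      using b(2) c bc by (auto simp: neighborhood_def)
    ultimately show ?thesis
      unfolding complete_digraph_pair_def by blast
  qed
  ultimately show ?thesis by blast
qed

lemma K2_product_le:
  assumes G: "complete_digraph 2 (with_proj G)" and H: "pair_graph H"
    and ncomplete: "\<not> complete_digraph (card (pverts H)) (with_proj H)"
  shows "super_domination_number (lexicographic_product G H) \<le> 2 * (card (pverts H) - 1)"
proof -
  interpret H: pair_graph H by fact
  have "card (pverts G) = 2"
    and arcs: "parcs G = {(u, v). (u, v) \<in> pverts G \<times> pverts G \<and> u \<noteq> v}"
    using G unfolding complete_digraph_pair_def by auto
  then obtain x y where xy: "pverts G = {x, y}" "x \<noteq> y"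
    by (auto simp: card_2_iff)
  have nb: "neighborhood G x = {y}" "neighborhood G y = {x}"
    using xy by (auto simp: neighborhood_def arcs)
  obtain b c where bc: "b \<in> pverts H" "c \<in> pverts H" "b \<noteq> c" "(b, c) \<notin> parcs H"
  proof -
    have "parcs H \<subseteq> {(u, v). (u, v) \<in> pverts H \<times> pverts H \<and> u \<noteq> v}"
      by (auto dest: H.in_arcsD1 H.in_arcsD2 H.pair_no_loops)
    then show ?thesis
      using that ncomplete H.pair_finite_verts unfolding complete_digraph_pair_def by blast
  qed
  define D where "D = {x, y} \<times> (pverts H - {c})"
  have compl: "pverts (lexicographic_product G H) - D = {(x, c), (y, c)}"
    using xy bc by (auto simp: D_def)
  have "c \<notin> neighborhood H b"
    using bc by (simp add: neighborhood_def)
  then have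
    "neighborhood (lexicographic_product G H) (y, b) \<inter> {(x, c), (y, c)} = {(x, c)}"
    "neighborhood (lexicographic_product G H) (x, b) \<inter> {(x, c), (y, c)} = {(y, c)}"
    using xy bc nb by (auto simp: neighborhood_lexicographic_product)
  moreover have "(x, b) \<in> D" "(y, b) \<in> D" "D \<subseteq> pverts (lexicographic_product G H)"
    using bc xy by (auto simp: D_def)
  ultimately have "super_dominating (lexicographic_product G H) D"
    unfolding super_dominating_def compl by blast
  moreover have "finite (pverts (lexicographic_product G H))"
    using xy by (simp add: H.pair_finite_verts)
  ultimately have "super_domination_number (lexicographic_product G H) \<le> card D"
    by (intro super_domination_number_le)
  also have "card D = 2 * (card (pverts H) - 1)"
    using xy bc H.pair_finite_verts by (simp add: D_def card_cartesian_product)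
  finally show ?thesis .
qed

theorem theorem11:
  fixes G :: "'a pair_pre_digraph" and H :: "'b pair_pre_digraph" and n n' :: nat
  assumes "pair_graph G" and "card (pverts G) = n" and "n \<ge> 2"
    and "pair_graph H" and "card (pverts H) = n'" and "nonempty_graph H"
  shows "super_domination_number (lexicographic_product G H) \<ge> n * super_domination_number H \<and>
    (connected (with_proj G) \<longrightarrow>
      (super_domination_number (lexicographic_product G H) = n * super_domination_number H \<longleftrightarrow>
        complete_digraph 2 (with_proj G) \<and>
        super_domination_number H = n' - 1 \<and>
        \<not> complete_digraph n' (with_proj H)))"
proof -
  have lower: "n * super_domination_number H
      \<le> super_domination_number (lexicographic_product G H)"
    using super_domination_number_lexicographic_product_ge[OF assms(1,4,6)] assms(2) by simp
  have "super_domination_number (lexicographic_product G H) = n * super_domination_number H"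
    if "complete_digraph 2 (with_proj G)" "super_domination_number H = n' - 1"
      "\<not> complete_digraph n' (with_proj H)"
  proof -
    have "n = 2"
      using that(1) assms(2) by (simp add: complete_digraph_pair_def)
    then show ?thesis
      using K2_product_le[OF that(1) assms(4)] that(2,3) assms(5) lower by simp
  qed
  moreover have "complete_digraph 2 (with_proj G) \<and> super_domination_number H = n' - 1 \<and>
      \<not> complete_digraph n' (with_proj H)"
    if "connected (with_proj G)"
      "super_domination_number (lexicographic_product G H) = n * super_domination_number H"
    using equality_imp_K2[OF assms(1,4,6) that(1)] that(2) assms(2,3,5) by simp
  ultimately show ?thesis
    using lower by blast
qed

end
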